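(* Let $B_1$ and $B_2$ be Boolean algebras, let $h\colon B_1\to B_2$ be a Boolean homomorphism, and let $h^\sigma\colon B_1^\sigma\to B_2^\sigma$ be its canonical extension. (1) If $h$ is a one-to-one homomorphism, then $h^{\sigma}$ is a one-to-one homomorphism. (2) If $h$ is an onto homomorphism, then $h^{\sigma}$ is an onto homomorphism. (3) If $h$ is an isomorphism, then $h^{\sigma}$ is an isomorphism.
   Context: For a Boolean algebra $B$, $\mathsf{Fi}(B)$ is the set of all (not necessarily proper) filters of $B$, $\mathsf{Uf}(B)$ is the set of all ultrafilters of $B$, and $\mathcal{P}(X)$ denotes the power set of $X$. The map $\varphi\colon B\to\mathcal{P}(\mathsf{Uf}(B))$ is $\varphi(a)=\{u\in\mathsf{Uf}(B): a\in u\}$. The canonical extension $B^\sigma$ of $B$ is identified with the pair $\langle\mathcal{P}(\mathsf{Uf}(B)),\varphi\rangle$, where $\mathcal{P}(\mathsf{Uf}(B))$ is regarded as a Boolean algebra under the usual set operations. Write $\varphi_i$ for the map $\varphi$ associated with $B_i$, $i=1,2$. The canonical extension of an order-preserving map $h\colon B_1\to B_2$ is the map $h^\sigma\colon\mathcal{P}(\mathsf{Uf}(B_1))\to\mathcal{P}(\mathsf{Uf}(B_2))$ given by $$h^\sigma(A)=\bigcup\left\{\bigcap\{\varphi_2(h(a)): a\in F\}: F\in\mathsf{Fi}(B_1),\ \bigcap\varphi_1[F]\subseteq A\right\},$$ where $\varphi_1[F]=\{\varphi_1(a):a\in F\}$. "Homomorphism" and "isomorphism" mean homomorphism and isomorphism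 of Boolean algebras. *)

theory Defs
  imports Main
begin

definition boolean_hom :: "('a::boolean_algebra \<Rightarrow> 'b::boolean_algebra) \<Rightarrow> bool" where
  "boolean_hom h \<longleftrightarrow>
     (\<forall>x y. h (inf x y) = inf (h x) (h y)) \<and>
     (\<forall>x y. h (sup x y) = sup (h x) (h y)) \<and>
     (\<forall>x. h (- x) = - h x) \<and>
     h bot = bot \<and> h top = top"

definition boolean_iso :: "('a::boolean_algebra \<Rightarrow> 'b::boolean_algebra) \<Rightarrow> bool" where
  "boolean_iso h \<longleftrightarrow> boolean_hom h \<and> bij h"

text \<open>Homomorphisms between the power set algebras of \<open>X\<close> and \<open>Y\<close>. The carriers are
  \<open>Pow X\<close> and \<open>Pow Y\<close>, and complements are relative to \<open>X\<close> and \<open>Y\<close>. The type-class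
  notion above does not apply: the ultrafilters of a one-element Boolean algebra form
  the empty set, so they cannot in general be made into a type.\<close>

definition Pow_hom :: "'a set \<Rightarrow> 'b set \<Rightarrow> ('a set \<Rightarrow> 'b set) \<Rightarrow> bool" where
  "Pow_hom X Y f \<longleftrightarrow>
     (\<forall>A\<in>Pow X. f A \<in> Pow Y) \<and>
     (\<forall>A\<in>Pow X. \<forall>B\<in>Pow X. f (A \<inter> B) = f A \<inter> f B) \<and>
     (\<forall>A\<in>Pow X. \<forall>B\<in>Pow X. f (A \<union> B) = f A \<union> f B) \<and>
     (\<forall>A\<in>Pow X. f (X - A) = Y - f A) \<and>
     f {} = {} \<and> f X = Y"

definition Pow_iso :: "'a set \<Rightarrow> 'b set \<Rightarrow> ('a set \<Rightarrow> 'b set) \<Rightarrow> bool" where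
  "Pow_iso X Y f \<longleftrightarrow> Pow_hom X Y f \<and> bij_betw f (Pow X) (Pow Y)"

text \<open>All filters, including the improper one \<open>UNIV\<close>.\<close>

definition Fi :: "'a::boolean_algebra set set" where
  "Fi = {F. top \<in> F \<and> (\<forall>x\<in>F. \<forall>y\<in>F. inf x y \<in> F) \<and> (\<forall>x\<in>F. \<forall>y. x \<le> y \<longrightarrow> y \<in> F)}"

text \<open>Ultrafilters are the maximal proper filters.\<close>

definition Uf :: "'a::boolean_algebra set set" where
  "Uf = {u \<in> Fi. u \<noteq> UNIV \<and> (\<forall>F\<in>Fi. u \<subseteq> F \<and> F \<noteq> UNIV \<longrightarrow> F = u)}"

definition phi :: "'a::boolean_algebra \<Rightarrow> 'a set set" where
  "phi a = {u \<in> Uf. a \<in> u}"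

text \<open>Filters are nonempty, so both intersections below range over nonempty families
  of subsets of \<open>Uf\<close>. Only arguments \<open>A \<in> Pow Uf\<close> are meaningful.\<close>

definition canonical_ext ::
    "('a::boolean_algebra \<Rightarrow> 'b::boolean_algebra) \<Rightarrow> 'a set set \<Rightarrow> 'b set set" where
  "canonical_ext h A = \<Union> {\<Inter> {phi (h a) | a. a \<in> F} | F. F \<in> Fi \<and> \<Inter> (phi ` F) \<subseteq> A}"

end

theory Submission imports Defs begin

text \<open>
  The proof is Stone duality. Preimage along a homomorphism \<open>h\<close> sends ultrafilters of
  \<open>B\<^sub>2\<close> to ultrafilters of \<open>B\<^sub>1\<close>, and the canonical extension is nothing but the inverse
  image map of this dual map:
  \<open>h\<^sup>\<sigma>(A) = {v. h\<^sup>-\<^sup>1[v] \<in> A}\<close> (lemma \<open>canonical_ext_eq_preimage\<close>). Indeed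
  \<open>\<Inter>\<phi>\<^sub>1[F]\<close> is the set of ultrafilters extending \<open>F\<close>, and \<open>v\<close> lies in
  \<open>\<Inter>{\<phi>\<^sub>2(h(a)). a \<in> F}\<close> iff \<open>h\<^sup>-\<^sup>1[v]\<close> extends \<open>F\<close>; so each member of the union
  consists of \<open>v\<close> with \<open>h\<^sup>-\<^sup>1[v] \<in> A\<close>, and each such \<open>v\<close> is reached by the choice
  \<open>F = h\<^sup>-\<^sup>1[v]\<close>, whose only ultrafilter extension is itself.

  An inverse image map is always a homomorphism of power set algebras. It is one-to-one
  when the underlying map is onto, and onto when the underlying map is one-to-one. If
  \<open>h\<close> is onto, the dual map is one-to-one because \<open>v = h[h\<^sup>-\<^sup>1[v]]\<close>. If \<open>h\<close> is one-to-one,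
  the dual map is onto: the filter generated by \<open>h[u]\<close> is proper, and any ultrafilter
  containing it has preimage \<open>u\<close>, by maximality of \<open>u\<close>. This last step is the only use
  of Zorn's lemma.
\<close>

section \<open>Filters and ultrafilters\<close>

lemma Fi_top: "F \<in> Fi \<Longrightarrow> top \<in> F"
  and Fi_inf: "F \<in> Fi \<Longrightarrow> x \<in> F \<Longrightarrow> y \<in> F \<Longrightarrow> inf x y \<in> F"
  and Fi_up: "F \<in> Fi \<Longrightarrow> x \<in> F \<Longrightarrow> x \<le> y \<Longrightarrow> y \<in> F"
  unfolding Fi_def by blast+

lemma Fi_proper_iff: "F \<in> Fi \<Longrightarrow> F \<noteq> UNIV \<longleftrightarrow> bot \<notin> F"
  using Fi_up[of F bot] by auto

lemma Uf_Fi: "u \<in> Uf \<Longrightarrow> u \<in> Fi"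
  and Uf_bot: "u \<in> Uf \<Longrightarrow> bot \<notin> u"
  and Uf_maximal: "u \<in> Uf \<Longrightarrow> F \<in> Fi \<Longrightarrow> bot \<notin> F \<Longrightarrow> u \<subseteq> F \<Longrightarrow> F = u"
  unfolding Uf_def using Fi_proper_iff by blast+

lemma Uf_antichain: "u \<in> Uf \<Longrightarrow> w \<in> Uf \<Longrightarrow> u \<subseteq> w \<Longrightarrow> w = u"
  using Uf_Fi Uf_bot Uf_maximal by blast

text \<open>If neither \<open>a\<close> nor its complement were in \<open>u\<close>, the filter generated by \<open>u\<close> and
  \<open>a\<close> would be a proper filter strictly larger than \<open>u\<close>.\<close>

lemma Uf_prime:
  assumes u: "u \<in> Uf"
  shows "a \<in> u \<or> - a \<in> u"
proof (rule ccontr)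
  assume neg: "\<not> (a \<in> u \<or> - a \<in> u)"
  note fi = Uf_Fi[OF u]
  define G where "G = {y. \<exists>x\<in>u. inf x a \<le> y}"
  have "G \<in> Fi"
  proof -
    have "inf y z \<in> G" if yz: "y \<in> G" "z \<in> G" for y z
    proof -
      obtain x x' where x: "x \<in> u" "inf x a \<le> y" and x': "x' \<in> u" "inf x' a \<le> z"
        using yz unfolding G_def by blast
      have "inf (inf x x') a \<le> inf y z"
        by (meson x(2) x'(2) inf.boundedI inf.cobounded1 inf.cobounded2 inf_mono order_trans order_refl)
      then show ?thesis using Fi_inf[OF fi x(1) x'(1)] unfolding G_def by blast
    qed
    then show ?thesis
      using Fi_top[OF fi] unfolding Fi_def G_def by (auto intro: order_trans)
  qed
  moreover have "bot \<notin> G"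
  proof
    assume "bot \<in> G"
    then obtain x where "x \<in> u" "inf x a = bot" unfolding G_def by (auto simp: bot_unique)
    then show False using neg Fi_up[OF fi, of x "- a"] by (simp add: inf_shunt)
  qed
  moreover have "u \<subseteq> G" unfolding G_def using inf.cobounded1 by blast
  ultimately have "G = u" by (rule Uf_maximal[OF u])
  moreover have "a \<in> G" unfolding G_def using Fi_top[OF fi] by auto
  ultimately show False using neg by blast
qed

lemma UfI:
  assumes F: "F \<in> Fi" "bot \<notin> F" and prime: "\<And>a. a \<in> F \<or> - a \<in> F"
  shows "F \<in> Uf"
proof -
  have "G \<subseteq> F" if G: "G \<in> Fi" "bot \<notin> G" "F \<subseteq> G" for G
  proof
    fix a assume "a \<in> G"
    then have "- a \<notin> G" using Fi_inf[OF G(1), of a "- a"] G(2) by auto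
    then show "a \<in> F" using prime[of a] G(3) by blast
  qed
  then show ?thesis unfolding Uf_def using F Fi_proper_iff by blast
qed

text \<open>Zorn's lemma applies because properness is the condition \<open>bot \<notin> F\<close>, which
  unions of chains preserve.\<close>

lemma proper_filter_extends_to_Uf:
  assumes F: "F \<in> Fi" "bot \<notin> F"
  obtains u where "u \<in> Uf" "F \<subseteq> u"
proof -
  define P where "P = {G \<in> Fi. bot \<notin> G \<and> F \<subseteq> G}"
  have "\<Union> C \<in> P" if ne: "C \<noteq> {}" and C: "subset.chain P C" for C
  proof -
    have sub: "C \<subseteq> P" and chain: "\<And>G H. G \<in> C \<Longrightarrow> H \<in> C \<Longrightarrow> G \<subseteq> H \<or> H \<subseteq> G"
      using C unfolding subset_chain_def by blast+
    then have fi: "\<And>G. G \<in> C \<Longrightarrow> G \<in> Fi" unfolding P_def by blast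
    have "inf x y \<in> \<Union> C" if xy: "x \<in> \<Union> C" "y \<in> \<Union> C" for x y
    proof -
      obtain G where "G \<in> C" "x \<in> G" "y \<in> G" using xy chain by blast
      then show ?thesis using fi Fi_inf by blast
    qed
    moreover have "top \<in> \<Union> C" using ne fi Fi_top by blast
    moreover have "\<And>x y. x \<in> \<Union> C \<Longrightarrow> x \<le> y \<Longrightarrow> y \<in> \<Union> C" using fi Fi_up by blast
    ultimately have "\<Union> C \<in> Fi" unfolding Fi_def by blast
    moreover have "bot \<notin> \<Union> C" "F \<subseteq> \<Union> C" using ne sub unfolding P_def by blast+
    ultimately show ?thesis unfolding P_def by blast
  qed
  moreover have "P \<noteq> {}" using F unfolding P_def by blast
  ultimately obtain u where u: "u \<in> P" "\<And>G. G \<in> P \<Longrightarrow> u \<subseteq> G \<Longrightarrow> G = u"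
    using subset_Zorn_nonempty[of P] by blast
  then have "u \<in> Uf" unfolding Uf_def P_def using Fi_proper_iff by blast
  with u(1) show thesis using that unfolding P_def by blast
qed

section \<open>The dual map on ultrafilters\<close>

lemma boolean_hom_mono:
  assumes "boolean_hom h" "x \<le> y"
  shows "h x \<le> h y"
  using assms unfolding boolean_hom_def by (metis le_iff_inf)

lemma vimage_Uf:
  assumes h: "boolean_hom h" and v: "v \<in> Uf"
  shows "h -` v \<in> Uf"
proof (rule UfI)
  show "h -` v \<in> Fi"
    using h Fi_top[OF Uf_Fi[OF v]] Fi_inf[OF Uf_Fi[OF v]] Fi_up[OF Uf_Fi[OF v]]
      boolean_hom_mono[OF h]
    unfolding Fi_def boolean_hom_def by auto
  show "bot \<notin> h -` v" using h Uf_bot[OF v] unfolding boolean_hom_def by simp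
  show "a \<in> h -` v \<or> - a \<in> h -` v" for a
    using h Uf_prime[OF v, of "h a"] unfolding boolean_hom_def by simp
qed

text \<open>Injectivity enters only in making the filter generated by \<open>h ` u\<close> proper: \<open>h a = bot\<close>
  forces \<open>a = bot\<close>.\<close>

lemma vimage_surj_on_Uf:
  assumes h: "boolean_hom h" and inj: "inj h" and u: "u \<in> Uf"
  shows "\<exists>v\<in>Uf. h -` v = u"
proof -
  note fi = Uf_Fi[OF u]
  define G where "G = {b. \<exists>a\<in>u. h a \<le> b}"
  have "inf y z \<in> G" if yz: "y \<in> G" "z \<in> G" for y z
  proof -
    obtain a a' where a: "a \<in> u" "h a \<le> y" and a': "a' \<in> u" "h a' \<le> z"
      using yz unfolding G_def by blast
    have "h (inf a a') \<le> inf y z"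
      using h inf_mono[OF a(2) a'(2)] unfolding boolean_hom_def by simp
    then show ?thesis using Fi_inf[OF fi a(1) a'(1)] unfolding G_def by blast
  qed
  then have "G \<in> Fi"
    using Fi_top[OF fi] unfolding Fi_def G_def by (auto intro: order_trans)
  moreover have "bot \<notin> G"
  proof
    assume "bot \<in> G"
    then obtain a where "a \<in> u" "h a = h bot"
      using h unfolding G_def boolean_hom_def by (auto simp: bot_unique)
    then show False using Uf_bot[OF u] injD[OF inj] by blast
  qed
  ultimately obtain v where v: "v \<in> Uf" "G \<subseteq> v" by (rule proper_filter_extends_to_Uf)
  then have "u \<subseteq> h -` v" unfolding G_def by auto
  then show ?thesis using Uf_antichain[OF u vimage_Uf[OF h v(1)]] v(1) by blast
qed

section \<open>The canonical extension as an inverse image map\<close>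

text \<open>Over all filters \<open>F\<close>, the best witness for \<open>v\<close> is the ultrafilter \<open>h -` v\<close> itself:
  \<open>\<Inter> (phi ` F)\<close> is then the singleton \<open>{h -` v}\<close>.\<close>

lemma canonical_ext_eq_preimage:
  assumes h: "boolean_hom h"
  shows "canonical_ext h A = {v \<in> Uf. h -` v \<in> A}"
proof -
  have phi_image: "\<Inter> (phi ` F) = {u \<in> Uf. F \<subseteq> u}" if "F \<in> Fi" for F :: "'a set"
    using Fi_top[OF that] unfolding phi_def by auto
  have phi_h: "\<Inter> {phi (h a) | a. a \<in> F} = {v \<in> Uf. F \<subseteq> h -` v}" if "F \<in> Fi" for F
    using Fi_top[OF that] unfolding phi_def by auto
  show ?thesis
  proof (intro set_eqI iffI)
    fix v assume "v \<in> canonical_ext h A"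
    then obtain F where F: "F \<in> Fi" "\<Inter> (phi ` F) \<subseteq> A" and "v \<in> \<Inter> {phi (h a) | a. a \<in> F}"
      unfolding canonical_ext_def by blast
    then have "v \<in> Uf" "F \<subseteq> h -` v" using phi_h[OF F(1)] by blast+
    moreover from this have "h -` v \<in> \<Inter> (phi ` F)"
      using vimage_Uf[OF h] phi_image[OF F(1)] by blast
    ultimately show "v \<in> {v \<in> Uf. h -` v \<in> A}" using F(2) by blast
  next
    fix v assume "v \<in> {v \<in> Uf. h -` v \<in> A}"
    then have v: "v \<in> Uf" and A: "h -` v \<in> A" by blast+
    note u = vimage_Uf[OF h v]
    have "\<Inter> (phi ` (h -` v)) \<subseteq> A"
      unfolding phi_image[OF Uf_Fi[OF u]] using Uf_antichain[OF u] A by blast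
    moreover have "v \<in> \<Inter> {phi (h a) | a. a \<in> h -` v}"
      unfolding phi_h[OF Uf_Fi[OF u]] using v by blast
    ultimately show "v \<in> canonical_ext h A"
      unfolding canonical_ext_def using Uf_Fi[OF u] by blast
  qed
qed

lemma Pow_hom_canonical_ext:
  assumes h: "boolean_hom h"
  shows "Pow_hom Uf Uf (canonical_ext h)"
  unfolding Pow_hom_def canonical_ext_eq_preimage[OF h] using vimage_Uf[OF h] by auto

lemma inj_on_canonical_ext:
  assumes h: "boolean_hom h" and inj: "inj h"
  shows "inj_on (canonical_ext h) (Pow Uf)"
proof (rule inj_onI)
  fix A B :: "'a set set"
  assume AB: "A \<in> Pow Uf" "B \<in> Pow Uf" "canonical_ext h A = canonical_ext h B"
  have "u \<in> A \<longleftrightarrow> u \<in> B" if "u \<in> Uf" for u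
    using vimage_surj_on_Uf[OF h inj that] AB(3)
    unfolding canonical_ext_eq_preimage[OF h] by blast
  then show "A = B" using AB(1,2) by blast
qed

text \<open>Surjectivity of \<open>h\<close> makes \<open>v \<mapsto> h -` v\<close> one-to-one, so a set \<open>D\<close> of ultrafilters
  is the inverse image of its image.\<close>

lemma canonical_ext_surj:
  assumes h: "boolean_hom h" and surj: "surj h"
  shows "canonical_ext h ` Pow Uf = Pow Uf"
proof
  show "canonical_ext h ` Pow Uf \<subseteq> Pow Uf"
    unfolding canonical_ext_eq_preimage[OF h] by blast
  show "Pow Uf \<subseteq> canonical_ext h ` Pow Uf"
  proof
    fix D :: "'b set set" assume D: "D \<in> Pow Uf"
    have dual_inj: "v = w" if "h -` v = h -` w" for v w
      using that surj_image_vimage_eq[OF surj] by metis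
    have "canonical_ext h ((\<lambda>v. h -` v) ` D) = D"
      unfolding canonical_ext_eq_preimage[OF h] using D dual_inj by blast
    moreover have "(\<lambda>v. h -` v) ` D \<in> Pow Uf" using D vimage_Uf[OF h] by blast
    ultimately show "D \<in> canonical_ext h ` Pow Uf" by (metis imageI)
  qed
qed

theorem corollary4p5:
  fixes h :: "'a::boolean_algebra \<Rightarrow> 'b::boolean_algebra"
  assumes "boolean_hom h"
  shows "(inj h \<longrightarrow>
            Pow_hom (Uf :: 'a set set) (Uf :: 'b set set) (canonical_ext h) \<and>
            inj_on (canonical_ext h) (Pow (Uf :: 'a set set))) \<and>
         (surj h \<longrightarrow>
            Pow_hom (Uf :: 'a set set) (Uf :: 'b set set) (canonical_ext h) \<and>
            canonical_ext h ` Pow (Uf :: 'a set set) = Pow (Uf :: 'b set set)) \<and>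
         (boolean_iso h \<longrightarrow>
            Pow_iso (Uf :: 'a set set) (Uf :: 'b set set) (canonical_ext h))"
  unfolding Pow_iso_def boolean_iso_def bij_def bij_betw_def
  using Pow_hom_canonical_ext[OF assms] inj_on_canonical_ext[OF assms]
    canonical_ext_surj[OF assms]
  by blast

end
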